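(* Let $k$ be an integer. Every sequence $r_n$ of integers that is an orbit of the recursion $x_{n+1}=x_n^2-k$ must satisfy one of the following conditions: (a) If $k=j(j+1)$ for some integer $j$ then $r_n$ is one of two constant sequences, $r_n=j+1$ or $r_n=-j$; (b) If $k=j(j+1)+1$ for some integer $j$ then $r_n$ is the 2-cycle $-(j+1),\,j$ for $n\geq 1$; (c) If the value of $k$ is not as given in (a) or (b) then $r_n$ diverges to infinity. In particular, there are no $p$-cycles for $p>2$.
   Context: An orbit of the recursion $x_{n+1}=x_n^2-k$ is a sequence $r_0,r_1,r_2,\ldots$ with $r_{n+1}=r_n^2-k$ for all $n\geq 0$, generated from an initial value $r_0$. A periodic orbit, or cycle, is an orbit for which there is a positive integer $p$ such that $r_{n+p}=r_n$ for all $n$; if $p$ is the smallest such positive integer, then $p$ is the period and the orbit is called a $p$-cycle.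
   Formalization: In (a), (b) orbits diverging to infinity are excluded (k=0, r_0=2 diverges); in (a) constancy for all n is claimed for periodic orbits, otherwise only from n=1 (k=0: -1,1,1,...), or from n=2 when k=2, r_0=0 (0,-2,2,...). *)

theory Defs
  imports Complex_Main
begin

definition orbit :: "int \<Rightarrow> (nat \<Rightarrow> int) \<Rightarrow> bool" where
  "orbit k r \<longleftrightarrow> (\<forall>n. r (Suc n) = (r n)\<^sup>2 - k)"

definition has_period :: "(nat \<Rightarrow> int) \<Rightarrow> nat \<Rightarrow> bool" where
  "has_period r p \<longleftrightarrow> p > 0 \<and> (\<forall>n. r (n + p) = r n)"

definition periodic_orbit :: "int \<Rightarrow> (nat \<Rightarrow> int) \<Rightarrow> bool" where
  "periodic_orbit k r \<longleftrightarrow> orbit k r \<and> (\<exists>p. has_period r p)"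

definition p_cycle :: "int \<Rightarrow> nat \<Rightarrow> (nat \<Rightarrow> int) \<Rightarrow> bool" where
  "p_cycle k p r \<longleftrightarrow> orbit k r \<and> has_period r p \<and> (\<forall>q. has_period r q \<longrightarrow> p \<le> q)"

definition diverges :: "(nat \<Rightarrow> int) \<Rightarrow> bool" where
  "diverges r \<longleftrightarrow> filterlim r at_top sequentially"

definition constant_from :: "nat \<Rightarrow> int \<Rightarrow> (nat \<Rightarrow> int) \<Rightarrow> bool" where
  "constant_from N a r \<longleftrightarrow> (\<forall>n\<ge>N. r n = a)"

text \<open>A 2-cycle has no distinguished first element, so both phases are allowed.\<close>

definition alternates_from :: "nat \<Rightarrow> int \<Rightarrow> int \<Rightarrow> (nat \<Rightarrow> int) \<Rightarrow> bool" where
  "alternates_from N a b r \<longleftrightarrow>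
     (\<forall>n\<ge>N. r n = (if even n then a else b)) \<or> (\<forall>n\<ge>N. r n = (if even n then b else a))"

text \<open>
  The index from which a non-divergent orbit is constant when \<open>k = j * (j + 1)\<close>. An orbit may
  start one step before a fixed point (for \<open>k = 0\<close>: \<open>-1, 1, 1, \<dots>\<close>), and for \<open>k = 2\<close> there is
  the single longer approach \<open>0, -2, 2, 2, \<dots>\<close>.
\<close>

definition constant_start :: "int \<Rightarrow> (nat \<Rightarrow> int) \<Rightarrow> nat" where
  "constant_start k r = (if k = 2 \<and> r 0 = 0 then 2 else 1)"

end

theory Submission
  imports Defs
begin

text \<open>
  If \<open>\<bar>x\<bar> < x\<^sup>2 - k\<close> at some term \<open>x\<close>, the orbit increases strictly from the next term on. Hence
  the terms of a non-divergent orbit satisfy \<open>\<bar>x\<bar> (\<bar>x\<bar> - 1) \<le> k\<close>. Choose \<open>B\<close> with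
  \<open>B (B - 1) \<le> k < B (B + 1)\<close>; then all terms lie in \<open>[-B, B]\<close>, and so
  \<open>x\<^sup>2 \<ge> k - B \<ge> B\<^sup>2 - 2 B\<close>, which forces \<open>\<bar>x\<bar> \<in> {B - 1, B}\<close>, except that \<open>x = 0\<close> may occur for
  \<open>k = 2\<close>. Two further steps of the recursion leave only \<open>k = B (B - 1)\<close> and
  \<open>k = B (B - 1) + 1\<close>.
\<close>

section \<open>Escape to infinity\<close>

lemma orbit_escape:
  assumes "orbit k r" and esc: "\<bar>r m\<bar> < (r m)\<^sup>2 - k"
  shows "diverges r"
proof -
  have step: "r (Suc n) = (r n)\<^sup>2 - k" for n
    using assms(1) by (simp add: orbit_def)
  \<comment> \<open>The second conjunct records linear growth, which is what yields divergence.
    Absolute values are used because \<open>r m\<close> itself may be negative.\<close>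
  have inv: "\<bar>r (m + i)\<bar> < (r (m + i))\<^sup>2 - k \<and> int i \<le> \<bar>r (m + i)\<bar>" for i
  proof (induction i)
    case 0
    show ?case using esc by simp
  next
    case (Suc i)
    define x where "x = \<bar>r (m + i)\<bar>"
    define y where "y = r (m + Suc i)"
    have y: "y = x\<^sup>2 - k" by (simp add: x_def y_def step)
    have x: "x \<ge> 0" "int i \<le> x" "x + 1 \<le> y" using Suc y by (simp_all add: x_def)
    \<comment> \<open>The inequality reproduces itself: \<open>y^2 - k\<close> is at least
      \<open>(x + 1)^2 - k = y + 2 * x + 1\<close>, which exceeds \<open>y\<close>.\<close>
    have "(x + 1)\<^sup>2 \<le> y\<^sup>2" using x by (intro power_mono) auto
    then have "x\<^sup>2 + 2 * x + 1 \<le> y\<^sup>2" by (simp add: power2_sum)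
    then have "y < y\<^sup>2 - k" using y x by linarith
    then show ?case using x by (simp add: y_def)
  qed
  have grow: "int i < r (m + Suc i)" for i
    using inv[of i] step[of "m + i"] by simp
  have "eventually (\<lambda>n. Z \<le> r n) sequentially" for Z
    unfolding eventually_sequentially
  proof (intro exI allI impI)
    fix n assume n: "m + Suc (nat Z) \<le> n"
    then obtain i where i: "n = m + Suc i" "nat Z \<le> i"
      by (intro that[of "n - Suc m"]) auto
    then show "Z \<le> r n" using grow[of i] by simp
  qed
  then show ?thesis by (simp add: diverges_def filterlim_at_top)
qed

section \<open>Locating the terms of a non-divergent orbit\<close>

text \<open>Consecutive intervals from \<open>B * (B - 1)\<close> up to \<open>B * (B + 1)\<close>
  tile the nonnegative integers; the induction moves on to \<open>B + 1\<close> when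
  \<open>k + 1\<close> reaches the right end.\<close>

lemma pronic_bracket:
  fixes k :: int
  assumes "k \<ge> 0"
  obtains B where "B \<ge> 1" "B * (B - 1) \<le> k" "k < B * (B + 1)"
proof -
  from assms have "\<exists>B\<ge>1. B * (B - 1) \<le> k \<and> k < B * (B + 1)"
  proof (induction k rule: int_ge_induct)
    case base
    show ?case by (rule exI[of _ 1]) simp
  next
    case (step k)
    then obtain B where B: "B \<ge> 1" "B * (B - 1) \<le> k" "k < B * (B + 1)" by blast
    show ?case
    proof (cases "k + 1 < B * (B + 1)")
      case True
      then show ?thesis using B by (intro exI[of _ B]) auto
    next
      case False
      then show ?thesis using B
        by (intro exI[of _ "B + 1"]) (auto simp: algebra_simps)
    qed
  qed
  then show thesis using that by blast
qed

lemma bounded_orbit_cases: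
  assumes "orbit k r" and "\<not> diverges r"
  obtains B where "B \<ge> 1" "k = B * (B - 1) \<or> k = B * (B - 1) + 1"
    "\<And>n. \<bar>r n\<bar> = B \<or> \<bar>r n\<bar> = B - 1 \<or> k = 2 \<and> B = 2 \<and> r n = 0"
proof -
  have step: "r (Suc n) = (r n)\<^sup>2 - k" for n
    using assms(1) by (simp add: orbit_def)
  have ub: "(r n)\<^sup>2 - k \<le> \<bar>r n\<bar>" for n
    using orbit_escape[OF assms(1)] assms(2) by (meson not_le)
  have "\<bar>r 0\<bar> * 1 \<le> \<bar>r 0\<bar> * \<bar>r 0\<bar>"
    by (cases "r 0 = 0") (simp, intro mult_left_mono, auto)
  then have "k \<ge> 0" using ub[of 0] by (simp add: power2_eq_square)
  then obtain B where B: "B \<ge> 1" "B * (B - 1) \<le> k" "k < B * (B + 1)"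
    by (rule pronic_bracket)
  \<comment> \<open>The offset of \<open>k\<close> within its bracket; the aim is
    \<open>d \<le> 1\<close>.\<close>
  define d where "d = k - B * (B - 1)"
  have k: "k = B * B - B + d" and d: "0 \<le> d" "d < 2 * B"
    using B by (simp_all add: d_def algebra_simps)
  have le: "\<bar>r n\<bar> \<le> B" for n
  proof (rule ccontr)
    assume "\<not> \<bar>r n\<bar> \<le> B"
    then have "(B + 1) * B \<le> \<bar>r n\<bar> * (\<bar>r n\<bar> - 1)" using B by (intro mult_mono) auto
    then show False using ub[of n] B by (simp add: power2_eq_square algebra_simps)
  qed
  have exc: "\<bar>r n\<bar> = B \<or> \<bar>r n\<bar> = B - 1 \<or> k = 2 \<and> B = 2 \<and> r n = 0" for n
  proof (cases "\<bar>r n\<bar> \<le> B - 2")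
    case True
    \<comment> \<open>The next term is at least \<open>- B\<close>, so \<open>(r n)^2\<close> is at
      least \<open>k - B\<close>. Comparing with \<open>(B - 2)^2\<close> gives
      \<open>2 * B + d \<le> 4\<close>, while \<open>B\<close> is at least 2 here.\<close>
    then have "\<bar>r n\<bar> * \<bar>r n\<bar> \<le> (B - 2) * (B - 2)" by (intro mult_mono) auto
    then have "B * B - 2 * B + d \<le> (B - 2) * (B - 2)"
      using le[of "Suc n"] k step[of n] by (simp add: power2_eq_square)
    then have "B = 2" "d = 0" using True d by (auto simp: algebra_simps)
    then show ?thesis using True k by auto
  next
    case False
    then show ?thesis using le[of n] by linarith
  qed
  have low: "d \<le> 1" if "\<bar>r n\<bar> = B - 1" for n
  proof -
    \<comment> \<open>The successor is \<open>1 - B - d\<close>, and it must not fall below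
      \<open>- B\<close>.\<close>
    have "(r n)\<^sup>2 = (B - 1) * (B - 1)"
      using that by (metis power2_abs power2_eq_square)
    then show ?thesis using step[of n] le[of "Suc n"] k by (simp add: algebra_simps)
  qed
  have "d \<le> 1"
  proof (cases "\<bar>r 0\<bar> = B")
    case True
    then have "(r 0)\<^sup>2 = B * B" by (metis power2_abs power2_eq_square)
    then have "r 1 = B - d" using step[of 0] k by simp
    \<comment> \<open>The value \<open>- B\<close> for \<open>r 1\<close> would need
      \<open>d = 2 * B\<close>, which is out of range; \<open>B\<close> gives \<open>d = 0\<close>,
      modulus \<open>B - 1\<close> is settled by \<open>low\<close>, and the exception has
      \<open>d = 0\<close>.\<close>
    then show ?thesis using exc[of 1] low[of 1] k d by auto
  next
    case False
    then show ?thesis using exc[of 0] low[of 0] k by auto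
  qed
  then have "k = B * (B - 1) \<or> k = B * (B - 1) + 1"
    using d k by (auto simp: algebra_simps)
  then show thesis using that B exc by blast
qed

section \<open>Fixed points and 2-cycles\<close>

lemma constant_from_fixed_point:
  assumes "orbit k r" "r N = c" "c\<^sup>2 - k = c"
  shows "constant_from N c r"
  unfolding constant_from_def
proof (intro allI impI)
  fix n assume "N \<le> n"
  then show "r n = c"
    by (induction n rule: dec_induct) (use assms in \<open>simp_all add: orbit_def\<close>)
qed

lemma alternates_from_2_cycle:
  assumes "orbit k r" "r N = a \<or> r N = b" "a\<^sup>2 - k = b" "b\<^sup>2 - k = a"
  shows "alternates_from N a b r"
proof -
  have step: "r n = a \<Longrightarrow> r (Suc n) = b" "r n = b \<Longrightarrow> r (Suc n) = a" for n
    using assms(1,3,4) by (metis orbit_def)+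
  \<comment> \<open>Parity is taken relative to \<open>N\<close>; an odd \<open>N\<close> swaps the
    phases, which \<open>alternates_from\<close> allows.\<close>
  have alt: "\<forall>n\<ge>N. r n = (if even n = even N then c else d)"
    if "r N = c" "\<And>n. r n = c \<Longrightarrow> r (Suc n) = d" "\<And>n. r n = d \<Longrightarrow> r (Suc n) = c" for c d
  proof (intro allI impI)
    fix n assume "N \<le> n"
    then show "r n = (if even n = even N then c else d)"
      by (induction n rule: dec_induct) (auto simp: that split: if_splits)
  qed
  from assms(2) show ?thesis
  proof
    assume "r N = a"
    from alt[OF this step] show ?thesis
      by (cases "even N") (auto simp: alternates_from_def)
  next
    assume "r N = b"
    from alt[OF this step(2,1)] show ?thesis
      by (cases "even N") (auto simp: alternates_from_def)
  qed
qed

text \<open>The fixed points are \<open>B\<close> and \<open>- (B - 1)\<close>, and squaring removes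
  the sign of \<open>r 0\<close>, so one step reaches them unless \<open>r 0\<close> is the
  exceptional 0.\<close>

lemma bounded_orbit_pronic:
  assumes "orbit k r" "\<not> diverges r" and k: "k = j * (j + 1)"
  shows "constant_from (constant_start k r) (j + 1) r \<or> constant_from (constant_start k r) (- j) r"
proof -
  from assms(1,2) obtain B where B: "B \<ge> 1" "k = B * (B - 1) \<or> k = B * (B - 1) + 1"
    "\<And>n. \<bar>r n\<bar> = B \<or> \<bar>r n\<bar> = B - 1 \<or> k = 2 \<and> B = 2 \<and> r n = 0"
    by (rule bounded_orbit_cases) blast
  \<comment> \<open>Parity separates the two forms of \<open>k\<close>.\<close>
  have "even (j * (j + 1))" "even (B * (B - 1))" by auto
  then have kB: "k = B * (B - 1)" using B(2) k by (metis even_plus_one_iff)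
  then have "(j + B) * (j - (B - 1)) = 0" using k by (simp add: algebra_simps)
  \<comment> \<open>Both choices of \<open>j\<close> give the same pair \<open>j + 1\<close>,
    \<open>- j\<close>.\<close>
  then have j: "j = - B \<or> j = B - 1" by auto
  have step: "r (Suc n) = (r n)\<^sup>2 - k" for n
    using assms(1) by (simp add: orbit_def)
  let ?N = "constant_start k r"
  have "r ?N = B \<or> r ?N = - (B - 1)"
  proof (cases "k = 2 \<and> r 0 = 0")
    case True
    then have "r 1 = - 2" using step[of 0] by simp
    then have "r 2 = 2" using step[of 1] True by (simp add: numeral_2_eq_2)
    moreover from this have "B = 2" using B(3)[of 0] True B(1) kB by auto
    ultimately show ?thesis using True by (simp add: constant_start_def)
  next
    case False
    then have "\<bar>r 0\<bar> = B \<or> \<bar>r 0\<bar> = B - 1" using B(3)[of 0] by blast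
    then have "(r 0)\<^sup>2 = B * B \<or> (r 0)\<^sup>2 = (B - 1) * (B - 1)"
      by (metis power2_abs power2_eq_square)
    then have "r 1 = B \<or> r 1 = - (B - 1)"
      using step[of 0] kB by (auto simp: algebra_simps)
    then show ?thesis using False by (auto simp: constant_start_def)
  qed
  moreover have "B\<^sup>2 - k = B" "(- (B - 1))\<^sup>2 - k = - (B - 1)"
    using kB by (simp_all add: power2_eq_square algebra_simps)
  ultimately have "constant_from ?N B r \<or> constant_from ?N (- (B - 1)) r"
    using constant_from_fixed_point[OF assms(1)] by blast
  then show ?thesis using j by auto
qed

lemma bounded_orbit_pronic_plus_1:
  assumes "orbit k r" "\<not> diverges r" and k: "k = j * (j + 1) + 1"
  shows "alternates_from 1 (- (j + 1)) j r"
proof -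
  from assms(1,2) obtain B where B: "B \<ge> 1" "k = B * (B - 1) \<or> k = B * (B - 1) + 1"
    "\<And>n. \<bar>r n\<bar> = B \<or> \<bar>r n\<bar> = B - 1 \<or> k = 2 \<and> B = 2 \<and> r n = 0"
    by (rule bounded_orbit_cases) blast
  have ev: "even (j * (j + 1))" "even (B * (B - 1))" by auto
  then have kB: "k = B * (B - 1) + 1" using B(2) k by (metis even_plus_one_iff)
  then have "(j + B) * (j - (B - 1)) = 0" using k by (simp add: algebra_simps)
  then have j: "j = - B \<or> j = B - 1" by auto
  \<comment> \<open>Here \<open>k\<close> is odd, so the exceptional term 0 cannot occur.\<close>
  have "k \<noteq> 2" using k ev(1) by (metis even_numeral even_plus_one_iff)
  then have abs: "\<bar>r 0\<bar> = B \<or> \<bar>r 0\<bar> = B - 1" using B(3)[of 0] by blast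
  have step: "r 1 = (r 0)\<^sup>2 - k" using assms(1) by (simp add: orbit_def)
  from abs have "(r 0)\<^sup>2 = B * B \<or> (r 0)\<^sup>2 = (B - 1) * (B - 1)"
    by (metis power2_abs power2_eq_square)
  then have "r 1 = B - 1 \<or> r 1 = - B"
    using step kB by (auto simp: algebra_simps)
  then have "r 1 = - (j + 1) \<or> r 1 = j" using j by auto
  then show ?thesis
    by (rule alternates_from_2_cycle[OF assms(1)])
      (simp_all add: k power2_eq_square algebra_simps)
qed

section \<open>Periodic orbits\<close>

lemma has_period_mult:
  assumes "has_period r p"
  shows "r (n + m * p) = r n"
proof (induction m)
  case (Suc m)
  have "r (n + Suc m * p) = r ((n + m * p) + p)" by (simp add: algebra_simps)
  then show ?case using assms Suc by (simp add: has_period_def)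
qed simp

text \<open>The value \<open>r 0\<close> recurs at arbitrarily late indices.\<close>

lemma has_period_not_diverges:
  assumes "has_period r p"
  shows "\<not> diverges r"
proof
  assume "diverges r"
  then have "eventually (\<lambda>n. r 0 + 1 \<le> r n) sequentially"
    by (simp add: diverges_def filterlim_at_top)
  then obtain N where N: "\<And>n. N \<le> n \<Longrightarrow> r 0 + 1 \<le> r n"
    unfolding eventually_sequentially by blast
  have "N \<le> N * p" using assms by (simp add: has_period_def)
  then show False using N[of "N * p"] has_period_mult[OF assms, of 0 N] by simp
qed

text \<open>Adding \<open>N\<close> periods moves any index past \<open>N\<close> without changing
  the term, so eventual behaviour already holds from the start.\<close>

lemma periodic_constant_from:
  assumes "has_period r p" "constant_from N c r"
  shows "constant_from 0 c r"
proof -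
  have "N \<le> n + N * p" for n using assms(1) by (simp add: has_period_def trans_le_add2)
  then show ?thesis using assms(2) has_period_mult[OF assms(1), of _ N]
    by (metis constant_from_def)
qed

lemma periodic_alternates_from:
  assumes "has_period r p" "alternates_from N a b r"
  shows "has_period r 2"
proof -
  have "r (n + 2) = r n" for n
  proof -
    have "N \<le> n + N * p" using assms(1) by (simp add: has_period_def trans_le_add2)
    then have "r (n + N * p + 2) = r (n + N * p)"
      using assms(2) by (auto simp: alternates_from_def)
    then show ?thesis
      using has_period_mult[OF assms(1), of n N] has_period_mult[OF assms(1), of "n + 2" N]
      by (simp add: algebra_simps)
  qed
  then show ?thesis by (simp add: has_period_def)
qed

lemma bounded_orbit_parameter:
  assumes "orbit k r" "\<not> diverges r"
  shows "(\<exists>j. k = j * (j + 1)) \<or> (\<exists>j. k = j * (j + 1) + 1)"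
proof -
  from assms obtain B where "k = B * (B - 1) \<or> k = B * (B - 1) + 1"
    by (rule bounded_orbit_cases)
  then have "k = (B - 1) * (B - 1 + 1) \<or> k = (B - 1) * (B - 1 + 1) + 1"
    by (simp add: mult.commute)
  then show ?thesis by blast
qed

lemma periodic_orbit_pronic:
  assumes "orbit k r" "has_period r p" "k = j * (j + 1)"
  shows "constant_from 0 (j + 1) r \<or> constant_from 0 (- j) r"
  using bounded_orbit_pronic[OF assms(1) has_period_not_diverges[OF assms(2)] assms(3)]
    periodic_constant_from[OF assms(2)] by blast

text \<open>This rules out least periods above 2: fixed points and 2-cycles alike return after two
  steps.\<close>

lemma periodic_orbit_has_period_2:
  assumes "orbit k r" "has_period r p"
  shows "has_period r 2"
proof -
  have nd: "\<not> diverges r" using assms(2) by (rule has_period_not_diverges)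
  from bounded_orbit_parameter[OF assms(1) nd] show ?thesis
  proof (elim disjE exE)
    fix j assume "k = j * (j + 1)"
    from periodic_orbit_pronic[OF assms this] show ?thesis
      by (auto simp: constant_from_def has_period_def)
  next
    fix j assume "k = j * (j + 1) + 1"
    from bounded_orbit_pronic_plus_1[OF assms(1) nd this] show ?thesis
      by (rule periodic_alternates_from[OF assms(2)])
  qed
qed

theorem theorem6:
  fixes k :: int and r :: "nat \<Rightarrow> int"
  assumes "orbit k r"
  shows "(\<forall>j. k = j * (j + 1) \<longrightarrow>
            (periodic_orbit k r \<longrightarrow> constant_from 0 (j + 1) r \<or> constant_from 0 (- j) r) \<and>
            (\<not> diverges r \<longrightarrow>
               constant_from (constant_start k r) (j + 1) r \<or>
               constant_from (constant_start k r) (- j) r)) \<and>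
         (\<forall>j. k = j * (j + 1) + 1 \<longrightarrow>
            (\<not> diverges r \<longrightarrow> alternates_from 1 (- (j + 1)) j r)) \<and>
         ((\<nexists>j. k = j * (j + 1)) \<and> (\<nexists>j. k = j * (j + 1) + 1) \<longrightarrow> diverges r) \<and>
         (\<forall>p>2. \<not> p_cycle k p r)"
proof (intro conjI allI impI)
  fix j assume k: "k = j * (j + 1)"
  show "constant_from 0 (j + 1) r \<or> constant_from 0 (- j) r" if "periodic_orbit k r"
    using that periodic_orbit_pronic[OF assms _ k] by (auto simp: periodic_orbit_def)
  show "constant_from (constant_start k r) (j + 1) r \<or> constant_from (constant_start k r) (- j) r"
    if "\<not> diverges r"
    using bounded_orbit_pronic[OF assms that k] .
next
  fix j assume "k = j * (j + 1) + 1" "\<not> diverges r"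
  then show "alternates_from 1 (- (j + 1)) j r"
    using bounded_orbit_pronic_plus_1[OF assms] by blast
next
  assume "(\<nexists>j. k = j * (j + 1)) \<and> (\<nexists>j. k = j * (j + 1) + 1)"
  then show "diverges r" using bounded_orbit_parameter[OF assms] by blast
next
  fix p :: nat assume "2 < p"
  then show "\<not> p_cycle k p r"
    using periodic_orbit_has_period_2[OF assms] by (force simp: p_cycle_def)
qed

end
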